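(* For every positive integer $n$, $$C_n(x)=\sum_{T\in\operatorname{SYT}(n)}\prod_{i=1}^n\sigma_i(T)\,A_i(x)^{w_i(T)}.$$
   Context: $A_n(x)=\sum_{\pi\in\mathfrak{S}_n}x^{{\rm des}(\pi)}$ where for $\pi=\pi_1\cdots\pi_n$ with $\pi_{n+1}=0$, ${\rm des}(\pi)=\#\{i\in[n]:\pi_i>\pi_{i+1}\}$. $\mathcal{Q}_n$ is the set of Stirling permutations of $\{1,1,\ldots,n,n\}$ (words using each of $1,\ldots,n$ twice such that all letters between the two occurrences of $i$ are $\geqslant i$); with $\sigma_0=\sigma_{2n+1}=0$, ${\rm des}(\sigma)=\#\{i\in\{0,\ldots,2n\}:\sigma_i>\sigma_{i+1}\}$ and $C_n(x)=\sum_{\sigma\in\mathcal{Q}_n}x^{{\rm des}(\sigma)}$. $\operatorname{SYT}(n)$ is the set of standard Young tableaux with $n$ boxes (French convention). $w_i(T)$ is the number of rows of $T$ with exactly $i$ boxes. For $1\leqslant i\leqslant n$, $T_i$ is obtained from $T$ by deleting entries $i+1,\ldots,n$, and $\operatorname{col}_k(T_i)$ is the size of its $k$-th column; $\sigma_i(T)=i-\operatorname{col}_1(T_i)+1$ if $i$ lies in the first column of $T$, and $\sigma_i(T)=\operatorname{col}_k(T_i)-\operatorname{col}_{k+1}(T_i)+1$ if $i$ lies in the $(k+1)$-th column, $k\geqslant1$. *)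

theory Defs
  imports
    "HOL-Combinatorics.Multiset_Permutations"
    "HOL-Computational_Algebra.Polynomial"
begin

definition descents :: "nat list \<Rightarrow> nat" where
  "descents w = card {i. Suc i < length w \<and> w ! i > w ! Suc i}"

(* Eulerian polynomial: a permutation is the word p_1 ... p_n, with p_{n+1} = 0 appended,
   so the last position is always a descent (for n > 0). *)
definition eulerian_poly :: "nat \<Rightarrow> int poly" where
  "eulerian_poly n = (\<Sum>p\<in>permutations_of_set {1..n}. monom 1 (descents (p @ [0])))"

definition stirling_permutations :: "nat \<Rightarrow> nat list set" where
  "stirling_permutations n =
     {s \<in> permutations_of_multiset (mset_set {1..n} + mset_set {1..n}).
        \<forall>a b c. a < b \<and> b < c \<and> c < length s \<and> s ! a = s ! c \<longrightarrow> s ! a \<le> s ! b}"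

(* Second-order Eulerian polynomial, with boundary letters s_0 = s_{2n+1} = 0. *)
definition stirling_eulerian_poly :: "nat \<Rightarrow> int poly" where
  "stirling_eulerian_poly n =
     (\<Sum>s\<in>stirling_permutations n. monom 1 (descents (0 # s @ [0])))"

(* A tableau is the list of its rows, from bottom to top (French convention): row lengths
   weakly decrease and entries increase along rows and up columns.  Rows are nonempty, so
   that each tableau is represented by exactly one list. *)
definition SYT :: "nat \<Rightarrow> nat list list set" where
  "SYT n =
     {T. [] \<notin> set T \<and>
         sorted_wrt (\<ge>) (map length T) \<and>
         distinct (concat T) \<and> set (concat T) = {1..n} \<and>
         (\<forall>row\<in>set T. sorted_wrt (<) row) \<and>
         (\<forall>r c. Suc r < length T \<and> c < length (T ! Suc r) \<longrightarrow> T ! r ! c < T ! Suc r ! c)}"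

definition row_count :: "nat \<Rightarrow> nat list list \<Rightarrow> nat" where
  "row_count i T = card {r. r < length T \<and> length (T ! r) = i}"

definition restrict_tableau :: "nat \<Rightarrow> nat list list \<Rightarrow> nat list list" where
  "restrict_tableau i T = filter (\<lambda>row. row \<noteq> []) (map (filter (\<lambda>j. j \<le> i)) T)"

(* Columns are numbered from 1. *)
definition column :: "nat \<Rightarrow> nat list list \<Rightarrow> nat set" where
  "column k T = {row ! (k - 1) | row. row \<in> set T \<and> 1 \<le> k \<and> k \<le> length row}"

definition col :: "nat \<Rightarrow> nat list list \<Rightarrow> nat" where
  "col k T = card (column k T)"

definition sigma :: "nat \<Rightarrow> nat list list \<Rightarrow> int" where
  "sigma i T =
     (let U = restrict_tableau i T in
      if i \<in> column 1 T then int i - int (col 1 U) + 1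
      else let k = (THE k. k \<ge> 1 \<and> i \<in> column (k + 1) T)
           in int (col k U) - int (col (k + 1) U) + 1)"

lemma finite_stirling_permutations: "finite (stirling_permutations n)"
  unfolding stirling_permutations_def by simp

lemma finite_SYT: "finite (SYT n)"
proof (rule finite_subset)
  let ?R = "{row. set row \<subseteq> {1..n} \<and> length row \<le> n}"
  show "SYT n \<subseteq> {T. set T \<subseteq> ?R \<and> length T \<le> n}"
  proof
    fix T assume T: "T \<in> SYT n"
    have len: "length (concat T) = n"
      using T distinct_card[of "concat T"] unfolding SYT_def by simp
    have "set row \<subseteq> {1..n} \<and> length row \<le> n" if row: "row \<in> set T" for row
    proof
      show "set row \<subseteq> {1..n}"
        using T row unfolding SYT_def by auto
      show "length row \<le> n"
        using len row member_le_sum_list[of "length row" "map length T"]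
        by (simp add: length_concat)
    qed
    then have rows: "set T \<subseteq> ?R"
      by blast
    have "length T \<le> length (concat T)" if "[] \<notin> set T" for T :: "nat list list"
      using that
    proof (induction T)
      case (Cons row T)
      then show ?case by (cases row) auto
    qed simp
    then have "length T \<le> n"
      using T len unfolding SYT_def by fastforce
    with rows show "T \<in> {T. set T \<subseteq> ?R \<and> length T \<le> n}"
      by blast
  qed
  show "finite {T. set T \<subseteq> ?R \<and> length T \<le> n}"
    by (intro finite_lists_length_le) simp_all
qed

end

theory Submission
  imports Defs
begin

text \<open>
  Let \<open>D\<close> be the derivation with \<open>D x = D y = x y\<close>.  Setting \<open>y = 1\<close>, the polynomial \<open>A\<^sub>k\<close> is
  \<open>D\<^sup>k y\<close> and \<open>C\<^sub>n\<close> is \<open>(y D)\<^sup>n y\<close>: this is the effect on descents of inserting a new largest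
  letter, once or twice in a row, into a word.  On the other hand, the Leibniz rule expands
  \<open>(y D)\<^sup>n y\<close> into products of the forms \<open>y\<^sub>k = D\<^sup>k y\<close>.  A product in which \<open>y\<^sub>k\<close> occurs \<open>m\<^sub>k\<close> times
  is recorded by the shape with \<open>m\<^sub>k\<close> rows of length \<open>k \<ge> 1\<close>, where \<open>m\<^sub>0\<close> is \<open>n + 1\<close> minus the number of rows.
  Applying \<open>D\<close> to one of the \<open>m\<^sub>k\<close> equal factors \<open>y\<^sub>k\<close> adds a box to a row of length \<open>k\<close>, and
  the multiplicity \<open>m\<^sub>k\<close> is \<open>\<sigma>\<^sub>i\<close> for the new entry \<open>i\<close>.
\<close>

section \<open>Insertion of a new largest letter\<close>

text \<open>
  On a form \<open>F\<close> of degree \<open>d\<close> in \<open>x, y\<close>, Euler's identity turns \<open>D F = x y (F\<^sub>x + F\<^sub>y)\<close> at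
  \<open>y = 1\<close> into the operator below, applied to \<open>f = F(x, 1)\<close>.
\<close>

definition eulerian_step :: "nat \<Rightarrow> int poly \<Rightarrow> int poly" where
  "eulerian_step d f = of_nat d * (monom 1 1 * f) + monom 1 1 * (1 - monom 1 1) * pderiv f"

text \<open>The Leibniz rule of \<open>D\<close> at \<open>y = 1\<close>: the degree term is
  additive in \<open>d\<close>, and the other term inherits the product rule of
  \<open>pderiv\<close>.\<close>

lemma eulerian_step_mult:
  "eulerian_step (a + b) (f * g) = eulerian_step a f * g + f * eulerian_step b g"
  unfolding eulerian_step_def pderiv_mult by (simp add: algebra_simps)

lemma eulerian_step_one: "eulerian_step d 1 = of_nat d * monom 1 1"
  by (simp add: eulerian_step_def)

lemma eulerian_step_sum: "eulerian_step d (\<Sum>s\<in>S. f s) = (\<Sum>s\<in>S. eulerian_step d (f s))"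
  by (simp add: eulerian_step_def higher_pderiv_sum[of 1, simplified] sum_distrib_left sum.distrib)

lemma eulerian_step_of_int_mult: "eulerian_step d (of_int z * f) = of_int z * eulerian_step d f"
  by (simp add: eulerian_step_def of_int_poly pderiv_smult algebra_simps)

text \<open>Here the form is \<open>x^d y^(m - d)\<close>. Replacing one of its \<open>d\<close>
  factors \<open>x\<close> by \<open>x y\<close> keeps the exponent of \<open>x\<close>; replacing
  one of the \<open>m - d\<close> factors \<open>y\<close> by \<open>x y\<close> raises it.\<close>

lemma eulerian_step_monom:
  assumes "d \<le> m"
  shows "eulerian_step m (monom 1 d) =
    of_nat d * monom 1 d + of_nat (m - d) * monom 1 (Suc d)"
proof (cases d)
  case 0
  then show ?thesis by (simp add: eulerian_step_def pderiv_monom)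
next
  case (Suc e)
  have "pderiv (monom 1 d) = (of_nat d * monom 1 e :: int poly)"
    using Suc by (simp add: pderiv_monom of_nat_monom mult_monom)
  then show ?thesis
    using assms Suc by (simp add: eulerian_step_def of_nat_diff algebra_simps mult_monom)
qed

section \<open>Descents after inserting a block\<close>

lemma descents_Cons_Cons:
  "descents (a # b # w) = (if a > b then 1 else 0) + descents (b # w)"
proof -
  let ?D = "\<lambda>w. {i. Suc i < length w \<and> w ! i > w ! Suc i}"
  have fin: "finite (?D (b # w))"
    by (rule finite_subset[of _ "{..<length (b # w)}"]) auto
  have "?D (a # b # w) = (if a > b then {0} else {}) \<union> Suc ` ?D (b # w)"
    (is "?L = ?R")
  proof (rule set_eqI)
    fix i show "i \<in> ?L \<longleftrightarrow> i \<in> ?R"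
      by (cases i) auto
  qed
  moreover have "card ?R = (if a > b then 1 else 0) + card (?D (b # w))"
    using fin by (subst card_Un_disjoint) (auto simp: card_image)
  ultimately show ?thesis by (simp add: descents_def)
qed

lemma descents_split:
  "descents (u @ a # b # v) = descents (u @ [a]) + (if a > b then 1 else 0) + descents (b # v)"
proof (induction u)
  case Nil
  then show ?case by (simp add: descents_Cons_Cons) (simp add: descents_def)
next
  case (Cons c u)
  then show ?case by (cases u) (auto simp: descents_Cons_Cons)
qed

lemma descents_replicate: "descents (replicate c m) = 0"
proof -
  have "{i. Suc i < c \<and> replicate c m ! i > replicate c m ! Suc i} = {}" by auto
  then show ?thesis by (simp only: descents_def length_replicate card.empty)
qed

text \<open>Entering the block is an ascent, its inside is constant and leaving it is a descent, so
  the block accounts for one descent whatever its length.\<close>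

lemma descents_insert_block:
  assumes "a < m" "b < m" "c > 0"
  shows "descents (u @ a # replicate c m @ b # v) = Suc (descents (u @ [a]) + descents (b # v))"
proof -
  obtain k where k: "c = Suc k" using \<open>c > 0\<close> by (cases c) auto
  have "descents (u @ a # replicate c m @ b # v)
      = descents (u @ [a]) + descents (replicate k m @ m # b # v)"
    using \<open>a < m\<close> descents_split[of u a m "replicate k m @ b # v"]
    by (simp add: k replicate_app_Cons_same)
  also have "descents (replicate k m @ m # b # v) = Suc (descents (b # v))"
    using \<open>b < m\<close> descents_replicate[of c m]
    by (simp add: descents_split[of "replicate k m"] k flip: replicate_append_same)
  finally show ?thesis by simp
qed

definition insert_block :: "nat \<Rightarrow> nat \<Rightarrow> nat list \<Rightarrow> nat \<Rightarrow> nat list" where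
  "insert_block c m s j = take j s @ replicate c m @ drop j s"

text \<open>A block put into a descent replaces that descent by its own; put into any other gap it
  creates a new one. With the boundary zeros there are \<open>Suc (length s)\<close> gaps, and
  counting both kinds gives the right side of \<open>eulerian_step_monom\<close>.\<close>

lemma sum_insert_block:
  assumes "c > 0" and s: "\<forall>x\<in>set s. x < m" and "m > 0"
  shows "(\<Sum>j\<le>length s. monom 1 (descents (0 # insert_block c m s j @ [0]))) =
    eulerian_step (Suc (length s)) (monom 1 (descents (0 # s @ [0])))"
proof -
  \<comment> \<open>With the boundary zeros included, gap \<open>j\<close> of \<open>s\<close> lies
    between \<open>w ! j\<close> and \<open>w ! Suc j\<close>.\<close>
  define w where "w = 0 # s @ [0]"
  define D where "D = {j. j \<le> length s \<and> w ! j > w ! Suc j}"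
  have D: "finite D" "D \<subseteq> {..length s}" "card D = descents w"
    by (auto simp: D_def w_def descents_def less_Suc_eq_le intro!: arg_cong[of _ _ card])
  have *: "descents (0 # insert_block c m s j @ [0]) = (if j \<in> D then descents w else Suc (descents w))"
    if j: "j \<le> length s" for j
  proof -
    have bound: "w ! i < m" if "i < length w" for i
      using s \<open>m > 0\<close> nth_mem[OF that] by (auto simp: w_def)
    have lw: "length w = length s + 2" by (simp add: w_def)
    have w: "w = take j w @ w ! j # w ! Suc j # drop (Suc (Suc j)) w"
      using j by (simp add: lw id_take_nth_drop Cons_nth_drop_Suc)
    have t: "0 # take j s = take j w @ [w ! j]"
      using j lw take_Suc_conv_app_nth[of j w] by (simp add: w_def)
    have d: "drop j s @ [0] = w ! Suc j # drop (Suc (Suc j)) w"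
      using j lw Cons_nth_drop_Suc[of "Suc j" w] by (simp add: w_def)
    have "0 # insert_block c m s j @ [0] = (0 # take j s) @ replicate c m @ (drop j s @ [0])"
      by (simp add: insert_block_def)
    also have "\<dots> = take j w @ w ! j # replicate c m @ w ! Suc j # drop (Suc (Suc j)) w"
      unfolding t d by simp
    finally have "descents (0 # insert_block c m s j @ [0])
        = Suc (descents (take j w @ [w ! j]) + descents (w ! Suc j # drop (Suc (Suc j)) w))"
      using descents_insert_block[of "w ! j" m "w ! Suc j" c] bound j \<open>c > 0\<close> lw by simp
    moreover have "descents w = descents (take j w @ [w ! j]) +
        (if w ! j > w ! Suc j then 1 else 0) + descents (w ! Suc j # drop (Suc (Suc j)) w)"
      by (subst w) (rule descents_split)
    ultimately show ?thesis using j by (simp add: D_def)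
  qed
  have "(\<Sum>j\<le>length s. monom 1 (descents (0 # insert_block c m s j @ [0])))
      = (\<Sum>j\<le>length s. if j \<in> D then monom 1 (descents w) else monom 1 (Suc (descents w)) :: int poly)"
    by (intro sum.cong) (auto simp: *)
  also have "\<dots> = of_nat (card D) * monom 1 (descents w)
      + of_nat (card ({..length s} - D)) * monom 1 (Suc (descents w))"
    using D by (simp add: sum.If_cases Int_absorb1 Diff_eq)
  also have "card ({..length s} - D) = Suc (length s) - card D"
    using D by (simp add: card_Diff_subset)
  also have "card D \<le> Suc (length s)"
    using card_mono[OF _ D(2)] by simp
  then have "of_nat (card D) * monom 1 (descents w)
      + of_nat (Suc (length s) - card D) * monom 1 (Suc (descents w))
      = eulerian_step (Suc (length s)) (monom 1 (descents w))"
    by (simp add: eulerian_step_monom D)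
  finally show ?thesis by (simp add: w_def)
qed

section \<open>Words built from blocks\<close>

text \<open>Treats both families at once: \<open>c = 1\<close> gives the permutations and
  \<open>c = 2\<close> the Stirling permutations.\<close>

definition stirling_words :: "nat \<Rightarrow> nat \<Rightarrow> nat list set" where
  "stirling_words c n =
     {s. mset s = repeat_mset c (mset_set {1..n}) \<and>
       (\<forall>i j k. i < j \<and> j < k \<and> k < length s \<and> s ! i = s ! k \<longrightarrow> s ! i \<le> s ! j)}"

lemma finite_stirling_words: "finite (stirling_words c n)"
proof (rule finite_subset)
  show "stirling_words c n \<subseteq> permutations_of_multiset (repeat_mset c (mset_set {1..n}))"
    by (auto simp: stirling_words_def permutations_of_multiset_def)
qed simp

lemma stirling_permutations_eq: "stirling_permutations n = stirling_words 2 n"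
  by (simp add: stirling_permutations_def stirling_words_def permutations_of_multiset_def
      numeral_2_eq_2)

lemma permutations_of_set_eq: "permutations_of_set {1..n} = stirling_words 1 n"
proof -
  have "s \<in> permutations_of_set {1..n} \<longleftrightarrow> s \<in> stirling_words 1 n" for s
  proof -
    have "mset s = mset_set {1..n} \<longleftrightarrow> set s = {1..n} \<and> distinct s"
      by (metis finite_atLeastAtMost finite_set_mset_mset_set mset_set_set set_mset_mset
          mset_eq_mset_set_imp_distinct)
    moreover have "distinct s \<Longrightarrow> i < k \<Longrightarrow> k < length s \<Longrightarrow> s ! i \<noteq> s ! k" for i k
      by (simp add: nth_eq_iff_index_eq)
    ultimately show ?thesis
      unfolding permutations_of_set_def stirling_words_def by (auto dest: less_trans)
  qed
  then show ?thesis by blast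
qed

lemma set_mset_repeat_mset: "set_mset (repeat_mset c M) = (if c = 0 then {} else set_mset M)"
  by (rule set_eqI) (simp flip: count_greater_zero_iff)

lemma stirling_words_set: "s \<in> stirling_words c n \<Longrightarrow> set s \<subseteq> {1..n}"
  
  by (auto simp: stirling_words_def set_mset_repeat_mset simp flip: set_mset_mset split: if_splits)

lemma stirling_words_length: "s \<in> stirling_words c n \<Longrightarrow> length s = c * n"
proof -
  assume "s \<in> stirling_words c n"
  then have "size (mset s) = size (repeat_mset c (mset_set {1..n}))"
    by (simp only: stirling_words_def mem_Collect_eq)
  then show ?thesis by simp
qed

text \<open>The new letters are contiguous, so two of them enclose only new letters. Two equal old
  letters enclose new letters, which are larger, or old letters that they already enclosed in
  \<open>s\<close>.\<close>

lemma insert_block_in_stirling_words: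
  assumes s: "s \<in> stirling_words c n" and j: "j \<le> length s"
  shows "insert_block c (Suc n) s j \<in> stirling_words c (Suc n)"
proof -
  let ?w = "insert_block c (Suc n) s j"
  have "mset ?w = mset (take j s @ drop j s) + replicate_mset c (Suc n)"
    unfolding insert_block_def mset_append by simp
  also have "\<dots> = repeat_mset c (mset_set {1..Suc n})"
    using s by (simp add: stirling_words_def atLeastAtMostSuc_conv)
  finally have m: "mset ?w = repeat_mset c (mset_set {1..Suc n})" .
  define g where "g i = (if i < j then i else i - c)" for i
  have len: "length ?w = length s + c" using j by (simp add: insert_block_def)
  have out: "?w ! i = s ! g i \<and> g i < length s" if "i < length ?w" "\<not> (j \<le> i \<and> i < j + c)" for i
    using that j len by (auto simp: insert_block_def nth_append g_def)
  have inside: "?w ! i = Suc n" if "j \<le> i" "i < j + c" for i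
    using that j by (auto simp: insert_block_def nth_append)
  have small: "s ! i < Suc n" if "i < length s" for i
    using stirling_words_set[OF s] nth_mem[OF that] by auto
  have "?w ! a \<le> ?w ! b" if abd: "a < b" "b < d" "d < length ?w" "?w ! a = ?w ! d" for a b d
  proof (cases "j \<le> b \<and> b < j + c")
    case True
    then have "?w ! b = Suc n" using inside by simp
    moreover have "?w ! a \<le> Suc n"
      using inside[of a] out[of a] small[of "g a"] abd by (cases "j \<le> a \<and> a < j + c") auto
    ultimately show ?thesis by simp
  next
    case b: False
    show ?thesis
    proof (cases "(j \<le> a \<and> a < j + c) \<or> (j \<le> d \<and> d < j + c)")
      case True
      \<comment> \<open>One end lies in the block and the middle does not, so the other end lies
        outside it and carries a smaller letter, against \<open>?w ! a = ?w ! d\<close>.\<close>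
      have False
      proof (cases "j \<le> a \<and> a < j + c")
        case True
        then have "\<not> (j \<le> d \<and> d < j + c)" using b abd by auto
        then show False using inside[of a] out[of d] small[of "g d"] True abd by auto
      next
        case False
        then show False using inside[of d] out[of a] small[of "g a"] True abd by auto
      qed
      then show ?thesis ..
    next
      case False
      then have "s ! g a = s ! g d" "g d < length s"
        using out[of a] out[of d] abd by auto
      moreover have "g a < g b" "g b < g d"
        using False b abd by (auto simp: g_def)
      ultimately have "s ! g a \<le> s ! g b"
        using s unfolding stirling_words_def by blast
      then show ?thesis using out[of a] out[of b] False b abd by auto
    qed
  qed
  then show ?thesis using m unfolding stirling_words_def by blast
qed

text \<open>Letters between two copies of the largest letter cannot be smaller, so its
  \<open>c\<close> copies form one run; deleting that run preserves the condition on enclosed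
  letters.\<close>

lemma stirling_words_split:
  assumes w: "w \<in> stirling_words c (Suc n)" and "c > 0"
  obtains u v where "w = u @ replicate c (Suc n) @ v" "u @ v \<in> stirling_words c n"
proof -
  define N where "N = Suc n"
  have mw: "mset w = repeat_mset c (mset_set {1..n}) + replicate_mset c N"
    using w by (simp add: stirling_words_def atLeastAtMostSuc_conv N_def)
  have between: "w ! i \<le> w ! j" if "i < j" "j < k" "k < length w" "w ! i = w ! k" for i j k
    using that w unfolding stirling_words_def by blast
  have "N \<in># mset w" using mw \<open>c > 0\<close> by simp
  then have "N \<in> set w" by simp
  then obtain u t where ut: "w = u @ N # t" "N \<notin> set u"
    by (auto dest: split_list_first)
  \<comment> \<open>The first \<open>N\<close> is followed by \<open>k\<close> adjoining copies of
    \<open>N\<close> and then by \<open>v\<close>.\<close>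
  define v where "v = dropWhile (\<lambda>x. x = N) t"
  define k where "k = length (takeWhile (\<lambda>x. x = N) t)"
  have "takeWhile (\<lambda>x. x = N) t = replicate k N"
    unfolding k_def by (induction t) auto
  then have t: "t = replicate k N @ v"
    unfolding v_def by (metis takeWhile_dropWhile_id)
  have "N \<notin> set v"
  proof
    assume "N \<in> set v"
    then obtain x where v: "v \<noteq> []" "x < length v" "v ! x = N" by (fastforce simp: in_set_conv_nth)
    have hd: "hd v \<noteq> N" using v(1) unfolding v_def by (rule hd_dropWhile)
    then have "x > 0" using v by (cases x) (auto simp: hd_conv_nth)
    \<comment> \<open>If \<open>v\<close> contained \<open>N\<close>, then \<open>hd v\<close>,
      which comes after \<open>u\<close> and \<open>k + 1\<close> copies of \<open>N\<close>, would
      be enclosed by two copies of \<open>N\<close> and hence be at least \<open>N\<close>.\<close>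
    let ?p = "length u + Suc k"
    have "w ! length u = N" "w ! ?p = hd v" "w ! (?p + x) = N" "?p + x < length w"
      using v by (auto simp: ut t nth_append hd_conv_nth)
    then have "N \<le> hd v"
      using between[of "length u" ?p "?p + x"] \<open>x > 0\<close> by simp
    moreover have "hd v \<in># mset w" using v(1) by (simp add: ut t)
    then have "hd v \<le> N"
      unfolding mw using \<open>c > 0\<close> by (auto simp: N_def set_mset_repeat_mset)
    ultimately show False using hd by simp
  qed
  have "count (mset w) N = Suc k"
    using \<open>N \<notin> set v\<close> \<open>N \<notin> set u\<close> by (simp add: ut t count_mset_0_iff)
  moreover have "count (mset w) N = c"
    unfolding mw by (simp add: N_def)
  ultimately have c: "c = Suc k" by simp
  have wuv: "w = u @ replicate c N @ v" by (simp add: ut t c)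
  have "mset (u @ v) = repeat_mset c (mset_set {1..n})"
    using mw unfolding wuv by simp
  moreover have "(u @ v) ! i \<le> (u @ v) ! j"
    if "i < j" "j < l" "l < length (u @ v)" "(u @ v) ! i = (u @ v) ! l" for i j l
  proof -
    define f where "f i = (if i < length u then i else i + c)" for i
    have "(u @ v) ! i = w ! f i" for i
      by (auto simp: f_def wuv nth_append)
    moreover have "f i < f j" "f j < f l" "f l < length w"
      using that by (auto simp: f_def wuv)
    ultimately show ?thesis using between[of "f i" "f j" "f l"] that by simp
  qed
  ultimately have "u @ v \<in> stirling_words c n"
    unfolding stirling_words_def by blast
  then show ?thesis using that wuv by (simp add: N_def)
qed

text \<open>Deleting all \<open>m\<close> recovers the word, and the length of the prefix before the
  first \<open>m\<close> recovers the gap.\<close>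

lemma insert_block_inj:
  assumes "m \<notin> set s" "m \<notin> set t" "c > 0" "i \<le> length s" "j \<le> length t"
    and eq: "insert_block c m s i = insert_block c m t j"
  shows "s = t \<and> i = j"
proof
  have "filter (\<lambda>x. x \<noteq> m) (insert_block c m s i) = s" if "m \<notin> set s" for s i
  proof -
    have "filter (\<lambda>x. x \<noteq> m) (insert_block c m s i) = filter (\<lambda>x. x \<noteq> m) (take i s @ drop i s)"
      unfolding insert_block_def filter_append by simp
    also have "\<dots> = s" using that by (simp add: filter_id_conv del: filter_append) auto
    finally show ?thesis .
  qed
  from this[of s i] this[of t j] show "s = t" using assms by simp
  have "length (takeWhile (\<lambda>x. x \<noteq> m) (insert_block c m s i)) = i"
    if "m \<notin> set s" "i \<le> length s" for s i
  proof -
    have "takeWhile (\<lambda>x. x \<noteq> m) (insert_block c m s i) = take i s"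
      using \<open>c > 0\<close> that in_set_takeD[of m i s] unfolding insert_block_def
      by (subst takeWhile_append2) (auto simp: gr0_conv_Suc)
    then show ?thesis using that by simp
  qed
  from this[of s i] this[of t j] show "i = j" using assms by simp
qed

section \<open>Recurrences for the descent polynomials\<close>

definition stirling_word_poly :: "nat \<Rightarrow> nat \<Rightarrow> int poly" where
  "stirling_word_poly c n = (\<Sum>s\<in>stirling_words c n. monom 1 (descents (0 # s @ [0])))"

lemma stirling_word_poly_0: "stirling_word_poly c 0 = 1"
proof -
  have "stirling_words c 0 = {[]}" by (auto simp: stirling_words_def)
  then show ?thesis by (simp add: stirling_word_poly_def descents_Cons_Cons) (simp add: descents_def)
qed

text \<open>Every word of order \<open>Suc n\<close> arises exactly once, from its subword of
  letters up to \<open>n\<close>, of length \<open>c * n\<close>, and one of the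
  \<open>Suc (c * n)\<close> gaps of that subword.\<close>

lemma stirling_word_poly_Suc:
  assumes "c > 0"
  shows "stirling_word_poly c (Suc n) = eulerian_step (Suc (c * n)) (stirling_word_poly c n)"
proof -
  let ?S = "SIGMA s:stirling_words c n. {..length s}"
  let ?f = "\<lambda>(s, j). insert_block c (Suc n) s j"
  have small: "x < Suc n" if "s \<in> stirling_words c n" "x \<in> set s" for s x
    using stirling_words_set[OF that(1)] that(2) by auto
  then have new: "Suc n \<notin> set s" if "s \<in> stirling_words c n" for s
    using that by blast
  have "bij_betw ?f ?S (stirling_words c (Suc n))"
    unfolding bij_betw_def
  proof
    show "inj_on ?f ?S"
    proof (rule inj_onI)
      fix x y assume "x \<in> ?S" "y \<in> ?S" "?f x = ?f y"
      then show "x = y"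
        using insert_block_inj[of "Suc n" "fst x" "fst y" c "snd x" "snd y"] new assms
        by (auto simp: split_def prod_eq_iff)
    qed
    show "?f ` ?S = stirling_words c (Suc n)"
    proof
      show "?f ` ?S \<subseteq> stirling_words c (Suc n)"
        using insert_block_in_stirling_words by auto
      show "stirling_words c (Suc n) \<subseteq> ?f ` ?S"
      proof
        fix w assume "w \<in> stirling_words c (Suc n)"
        then obtain u v where "w = u @ replicate c (Suc n) @ v" "u @ v \<in> stirling_words c n"
          using stirling_words_split assms by blast
        then show "w \<in> ?f ` ?S"
          by (intro image_eqI[of _ _ "(u @ v, length u)"]) (auto simp: insert_block_def)
      qed
    qed
  qed
  then have "stirling_word_poly c (Suc n) =
      (\<Sum>x\<in>?S. monom 1 (descents (0 # ?f x @ [0])))"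
    unfolding stirling_word_poly_def by (rule sum.reindex_bij_betw[symmetric])
  also have "\<dots> = (\<Sum>s\<in>stirling_words c n. \<Sum>j\<le>length s.
      monom 1 (descents (0 # insert_block c (Suc n) s j @ [0])))"
    by (simp add: sum.Sigma finite_stirling_words split_def)
  also have "\<dots> = (\<Sum>s\<in>stirling_words c n.
      eulerian_step (Suc (length s)) (monom 1 (descents (0 # s @ [0]))))"
    using small assms by (intro sum.cong refl sum_insert_block) auto
  also have "\<dots> = eulerian_step (Suc (c * n)) (stirling_word_poly c n)"
    by (simp add: stirling_word_poly_def eulerian_step_sum stirling_words_length)
  finally show ?thesis .
qed

lemma stirling_eulerian_poly_eq: "stirling_eulerian_poly n = stirling_word_poly 2 n"
  by (simp add: stirling_eulerian_poly_def stirling_word_poly_def stirling_permutations_eq)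

lemma eulerian_poly_eq: "eulerian_poly n = stirling_word_poly 1 n"
  unfolding eulerian_poly_def stirling_word_poly_def permutations_of_set_eq
proof (intro sum.cong refl arg_cong[of _ _ "monom 1"])
  fix s :: "nat list"
  \<comment> \<open>A leading \<open>0\<close> is never the top of a descent, so both boundary
    conventions agree.\<close>
  show "descents (s @ [0]) = descents (0 # s @ [0])"
    by (cases s) (simp_all add: descents_Cons_Cons)
qed

lemma eulerian_poly_0: "eulerian_poly 0 = 1"
  by (simp add: eulerian_poly_eq stirling_word_poly_0)

text \<open>\<open>eulerian_poly n\<close> stands for the form \<open>D^n y\<close>, whose degree is
  \<open>Suc n\<close>.\<close>

lemma eulerian_poly_Suc: "eulerian_poly (Suc n) = eulerian_step (Suc n) (eulerian_poly n)"
  by (simp add: eulerian_poly_eq stirling_word_poly_Suc)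

lemma eulerian_poly_1: "eulerian_poly 1 = monom 1 1"
  by (simp add: eulerian_poly_Suc eulerian_poly_0 eulerian_step_one)

section \<open>Standard Young tableaux\<close>

text \<open>Refers the conditions to neighbouring rows and a single multiset, where adding or
  removing one box has a local effect.\<close>

lemma SYT_iff:
  "T \<in> SYT n \<longleftrightarrow>
     [] \<notin> set T \<and>
     (\<forall>i. Suc i < length T \<longrightarrow> length (T ! Suc i) \<le> length (T ! i)) \<and>
     mset (concat T) = mset_set {1..n} \<and>
     (\<forall>i<length T. sorted_wrt (<) (T ! i)) \<and>
     (\<forall>i c. Suc i < length T \<and> c < length (T ! Suc i) \<longrightarrow> T ! i ! c < T ! Suc i ! c)"
proof -
  have "distinct (concat T) \<and> set (concat T) = {1..n} \<longleftrightarrow> mset (concat T) = mset_set {1..n}"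
    by (metis finite_atLeastAtMost finite_set_mset_mset_set mset_set_set set_mset_mset
        mset_eq_mset_set_imp_distinct)
  moreover have "sorted_wrt (\<ge>) (map length T) \<longleftrightarrow>
      (\<forall>i. Suc i < length T \<longrightarrow> length (T ! Suc i) \<le> length (T ! i))"
    by (subst sorted_wrt_iff_nth_Suc_transp) (auto simp: transp_def)
  ultimately show ?thesis
    unfolding SYT_def by (auto simp: all_set_conv_all_nth)
qed

lemma SYT_nth_nonempty: "T \<in> SYT n \<Longrightarrow> i < length T \<Longrightarrow> T ! i \<noteq> []"
  unfolding SYT_def by (auto dest: nth_mem)

lemma SYT_set: "T \<in> SYT n \<Longrightarrow> set (concat T) = {1..n}"
  by (simp add: SYT_def)

lemma SYT_row_le: "T \<in> SYT n \<Longrightarrow> row \<in> set T \<Longrightarrow> x \<in> set row \<Longrightarrow> x \<in> {1..n}"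
  using SYT_set[of T n] by auto

lemma SYT_length_mono:
  assumes "T \<in> SYT n" "i \<le> j" "j < length T"
  shows "length (T ! j) \<le> length (T ! i)"
proof (cases "i = j")
  case False
  then show ?thesis
    using assms sorted_wrt_nth_less[of "(\<ge>)" "map length T" i j] by (auto simp: SYT_def)
qed simp

lemma SYT_disjoint:
  assumes "T \<in> SYT n" "i < length T" "j < length T" "x \<in> set (T ! i)" "x \<in> set (T ! j)"
  shows "i = j"
proof (rule ccontr)
  assume "i \<noteq> j"
  have T: "distinct (concat T)" "[] \<notin> set T" using assms by (simp_all add: SYT_def)
  \<comment> \<open>Only empty rows could repeat while \<open>concat T\<close> is distinct.\<close>
  then have "distinct T" by (simp add: distinct_concat_iff)
  then have "T ! i \<noteq> T ! j" using \<open>i \<noteq> j\<close> assms by (simp add: nth_eq_iff_index_eq)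
  then have "set (T ! i) \<inter> set (T ! j) = {}"
    using T(1) assms by (simp add: distinct_concat_iff)
  then show False using assms by blast
qed

section \<open>Adding and removing the box with the largest entry\<close>

definition add_box :: "nat \<Rightarrow> nat list list \<Rightarrow> nat \<Rightarrow> nat list list" where
  "add_box m T r = (if r < length T then T[r := T ! r @ [m]] else T @ [[m]])"

text \<open>Rows that can be extended by a box without outgrowing the row below. In a tableau these
  are the lowest rows of each length; a new top row is treated separately.\<close>

definition corners :: "nat list list \<Rightarrow> nat set" where
  "corners T = {r. r < length T \<and> (r = 0 \<or> length (T ! r) < length (T ! (r - 1)))}"

lemma finite_corners: "finite (corners T)"
  by (simp add: corners_def)

definition shape :: "nat list list \<Rightarrow> nat multiset" where
  "shape T = mset (map length T)"

lemma length_add_box: "r \<le> length T \<Longrightarrow> length (add_box m T r) = max (length T) (Suc r)"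
  by (auto simp: add_box_def)

lemma nth_add_box:
  assumes "r \<le> length T" "i < length (add_box m T r)"
  shows "add_box m T r ! i =
    (if i = r then (if r < length T then T ! r else []) @ [m] else T ! i)"
  using assms by (auto simp: add_box_def nth_append)

lemma mset_concat_add_box: "mset (concat (add_box m T r)) = add_mset m (mset (concat T))"
proof (cases "r < length T")
  case True
  then have "T = take r T @ T ! r # drop (Suc r) T" by (rule id_take_nth_drop)
  then have "mset (concat T) = mset (concat (take r T @ T ! r # drop (Suc r) T))" by metis
  then show ?thesis
    using True by (simp add: add_box_def upd_conv_take_nth_drop)
qed (simp add: add_box_def)

lemma shape_add_box_corner:
  assumes "r < length T"
  shows "shape (add_box m T r) =
    add_mset (Suc (length (T ! r))) (shape T - {#length (T ! r)#})"
  using assms by (simp add: shape_def add_box_def map_update mset_update)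

lemma shape_add_box_top: "shape (add_box m T (length T)) = add_mset 1 (shape T)"
  by (simp add: shape_def add_box_def)

text \<open>The new entry is the largest and ends its row, so the order along rows and columns
  survives; the choice of \<open>r\<close> keeps the row lengths weakly decreasing.\<close>

lemma add_box_in_SYT:
  assumes T: "T \<in> SYT n" and r: "r \<in> insert (length T) (corners T)"
  shows "add_box (Suc n) T r \<in> SYT (Suc n)"
proof -
  let ?T = "add_box (Suc n) T r"
  have rl: "r \<le> length T" using r by (auto simp: corners_def)
  note nth = nth_add_box[OF rl]
  have len: "length ?T = max (length T) (Suc r)" using rl by (rule length_add_box)
  have small: "T ! i ! c < Suc n" if "i < length T" "c < length (T ! i)" for i c
    using SYT_row_le[OF T nth_mem nth_mem] that by (simp add: less_Suc_eq_le)
  note T' = T[unfolded SYT_iff]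
  \<comment> \<open>A new top row counts as empty so far, and the row below it is nonempty.\<close>
  have below: "length (if r < length T then T ! r else []) < length (T ! i)" if "r = Suc i" for i
    using r that SYT_nth_nonempty[OF T, of i] by (auto simp: corners_def)
  have "[] \<notin> set ?T"
    using T SYT_nth_nonempty[OF T] len rl by (auto simp: in_set_conv_nth nth max_def split: if_splits)
  moreover have "length (?T ! Suc i) \<le> length (?T ! i)" if "Suc i < length ?T" for i
  proof -
    consider "r = Suc i" | "r = i" | "r \<noteq> i" "r \<noteq> Suc i" by blast
    then show ?thesis
    proof cases
      case 1
      then have "i \<noteq> r" by simp
      then show ?thesis using below[OF 1] that Suc_lessD[OF that] by (simp add: nth Suc_le_eq flip: 1)
    next
      case 2
      then have "Suc r < length T" using that len by auto
      moreover from this have "length (T ! Suc r) \<le> length (T ! r)" using T' by blast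
      ultimately show ?thesis using that by (simp add: nth flip: 2)
    next
      case 3
      then have "Suc i < length T" using that len rl by auto
      then show ?thesis using T' that Suc_lessD[OF that] 3 by (auto simp: nth)
    qed
  qed
  moreover have "mset (concat ?T) = mset_set {1..Suc n}"
    using T' by (simp add: mset_concat_add_box atLeastAtMostSuc_conv)
  moreover have "sorted_wrt (<) (?T ! i)" if "i < length ?T" for i
  proof (cases "i = r")
    case True
    then show ?thesis
      using that T' SYT_row_le[OF T nth_mem] by (auto simp: nth sorted_wrt_append less_Suc_eq_le)
  next
    case False
    then have "i < length T" using that len rl by auto
    then show ?thesis using that T' False by (simp add: nth)
  qed
  moreover have "?T ! i ! c < ?T ! Suc i ! c" if "Suc i < length ?T" "c < length (?T ! Suc i)" for i c
  proof -
    consider "r = Suc i" | "r = i" | "r \<noteq> i" "r \<noteq> Suc i" by blast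
    then show ?thesis
    proof cases
      case 1
      then have "i < length T" using that rl len by auto
      have "i \<noteq> r" using 1 by simp
      have c: "c < Suc (length (if r < length T then T ! r else []))"
        using that by (simp add: nth flip: 1)
      then have "T ! i ! c < Suc n" using below[OF 1] \<open>i < length T\<close> small by simp
      moreover have "T ! i ! c < T ! r ! c" if "r < length T" "c < length (T ! r)"
        using T' that 1 by blast
      ultimately show ?thesis
        using c that \<open>i \<noteq> r\<close> Suc_lessD[OF that(1)]
        by (auto simp: nth nth_append less_Suc_eq simp flip: 1)
    next
      case 2
      then have "Suc r < length T" using that len by auto
      moreover from this have "length (T ! Suc r) \<le> length (T ! r)" using T' by blast
      moreover have "c < length (T ! Suc r)" using that by (simp add: nth flip: 2)
      ultimately have "c < length (T ! r)" "T ! r ! c < T ! Suc r ! c" using T' by auto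
      then show ?thesis using that \<open>Suc r < length T\<close> by (simp add: nth nth_append flip: 2)
    next
      case 3
      then have "Suc i < length T" using that len rl by auto
      then show ?thesis using T' that Suc_lessD[OF that(1)] 3 by (auto simp: nth)
    qed
  qed
  ultimately show ?thesis unfolding SYT_iff by blast
qed

text \<open>The largest entry ends its row and has nothing above it, so its box can be deleted. If
  its row is then empty, it was the top row and disappears.\<close>

lemma SYT_Suc_cases:
  assumes T': "T' \<in> SYT (Suc n)"
  obtains T r where "T \<in> SYT n" "r \<in> insert (length T) (corners T)" "T' = add_box (Suc n) T r"
proof -
  note props = T'[unfolded SYT_iff]
  have "Suc n \<in> set (concat T')" using SYT_set[OF T'] by simp
  then obtain r where r: "r < length T'" "Suc n \<in> set (T' ! r)"
    by (auto simp: in_set_conv_nth) (metis in_set_conv_nth)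
  then obtain row ys where row: "T' ! r = row @ Suc n # ys" by (meson split_list)
  have "ys = []"
  proof (rule ccontr)
    assume "ys \<noteq> []"
    then have y: "hd ys \<in> set ys" by simp
    have "sorted_wrt (<) (T' ! r)" using props r by blast
    then have "Suc n < hd ys" using y by (simp add: row sorted_wrt_append)
    moreover have "hd ys \<le> Suc n" using SYT_row_le[OF T' nth_mem[OF r(1)], of "hd ys"] y
      by (simp add: row)
    ultimately show False by simp
  qed
  with row have row: "T' ! r = row @ [Suc n]" by simp
  have nextrow: "length (T' ! Suc r) \<le> length row" if "Suc r < length T'"
  proof (rule ccontr)
    assume "\<not> ?thesis"
    then have c: "length row < length (T' ! Suc r)" by simp
    then have "T' ! r ! length row < T' ! Suc r ! length row" using props that by blast
    moreover have "T' ! Suc r ! length row \<le> Suc n"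
      using SYT_row_le[OF T' nth_mem[OF that] nth_mem[OF c]] by simp
    ultimately show False by (simp add: row)
  qed
  define T where "T = (if row = [] then take r T' else T'[r := row])"
  have top: "Suc r = length T'" if "row = []"
    using nextrow that SYT_nth_nonempty[OF T', of "Suc r"] r by (cases "Suc r < length T'") auto
  have T'_eq: "T' = add_box (Suc n) T r"
  proof (cases "row = []")
    case True
    then have "take r T' @ [[Suc n]] = T'"
      using top take_Suc_conv_app_nth[OF r(1)] row by simp
    then show ?thesis using True r by (simp add: T_def add_box_def)
  next
    case False
    then show ?thesis
      using r list_update_id[of T' r] by (simp add: T_def add_box_def row)
  qed
  have lenT: "length T = (if row = [] then r else length T')"
    using r by (simp add: T_def)
  have nth: "T ! i = (if i = r then row else T' ! i)" if "i < length T" for i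
    using that r by (auto simp: T_def split: if_splits)
  have "[] \<notin> set T"
    using SYT_nth_nonempty[OF T'] r by (auto simp: in_set_conv_nth nth lenT split: if_splits)
  moreover have "length (T ! Suc i) \<le> length (T ! i)" if i: "Suc i < length T" for i
  proof -
    have "length (T' ! Suc i) \<le> length (T' ! i)" using props i lenT r by (auto split: if_splits)
    then show ?thesis
      using i nextrow lenT row by (auto simp: nth split: if_splits)
  qed
  moreover have "mset (concat T) = mset_set {1..n}"
    using props unfolding T'_eq mset_concat_add_box by (simp add: atLeastAtMostSuc_conv)
  moreover have "sorted_wrt (<) (T ! i)" if "i < length T" for i
  proof -
    have "sorted_wrt (<) (T' ! i)" using props that lenT r by (auto split: if_splits)
    then show ?thesis using that row by (auto simp: nth sorted_wrt_append)
  qed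
  moreover have "T ! i ! c < T ! Suc i ! c" if i: "Suc i < length T" "c < length (T ! Suc i)" for i c
  proof -
    have "Suc i < length T'" using i lenT r by (auto split: if_splits)
    moreover have "c < length (T' ! Suc i)" using i row by (auto simp: nth split: if_splits)
    ultimately have "T' ! i ! c < T' ! Suc i ! c" using props by blast
    then show ?thesis
      using i row nextrow \<open>Suc i < length T'\<close> by (auto simp: nth nth_append split: if_splits)
  qed
  ultimately have "T \<in> SYT n" unfolding SYT_iff by blast
  moreover have "r \<in> insert (length T) (corners T)"
  proof (cases "row = []")
    case False
    \<comment> \<open>Row \<open>r\<close> of \<open>T\<close> is one box shorter than in
      \<open>T'\<close>, hence strictly shorter than the row below it, if there is one.\<close>
    have "length (T' ! r) \<le> length (T' ! (r - 1))"
      using SYT_length_mono[OF T', of "r - 1" r] r by simp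
    then show ?thesis
      using r False by (auto simp: corners_def lenT nth row)
  qed (simp add: lenT)
  ultimately show ?thesis using T'_eq that by blast
qed

section \<open>Columns and the numbers \<open>sigma\<close>\<close>

lemma column_iff:
  "x \<in> column k T \<longleftrightarrow> 1 \<le> k \<and> (\<exists>i<length T. k \<le> length (T ! i) \<and> T ! i ! (k - 1) = x)"
  by (auto simp: column_def in_set_conv_nth)

lemma column_add_box_old:
  assumes "r \<le> length T" "x \<noteq> m"
  shows "x \<in> column k (add_box m T r) \<longleftrightarrow> x \<in> column k T"
proof -
  have "k \<le> length (add_box m T r ! i) \<and> add_box m T r ! i ! (k - 1) = x \<longleftrightarrow>
      i < length T \<and> k \<le> length (T ! i) \<and> T ! i ! (k - 1) = x"
    if "i < length (add_box m T r)" "1 \<le> k" for i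
    using that assms
    by (cases "i = r") (auto simp: nth_add_box nth_append length_add_box max_def split: if_splits)
  moreover have "i < length (add_box m T r)" if "i < length T" for i
    using that assms by (simp add: length_add_box)
  ultimately show ?thesis unfolding column_iff by (smt (verit, best))
qed

lemma column_add_box_new:
  assumes "r \<le> length T" "m \<notin> set (concat T)"
  shows "m \<in> column k (add_box m T r) \<longleftrightarrow> k = Suc (if r < length T then length (T ! r) else 0)"
proof -
  have old: "T ! i ! (k - 1) \<noteq> m" if "i < length T" "k \<le> length (T ! i)" "1 \<le> k" for i
  proof -
    have "T ! i ! (k - 1) \<in> set (T ! i)" "T ! i \<in> set T" using that by auto
    then show ?thesis using assms(2) by auto
  qed
  have "1 \<le> k \<and> k \<le> length (add_box m T r ! i) \<and> add_box m T r ! i ! (k - 1) = m \<longleftrightarrow>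
      i = r \<and> k = Suc (if r < length T then length (T ! r) else 0)"
    if "i < length (add_box m T r)" for i
    using that assms(1) old[of i]
    by (cases "i = r")
      (auto simp: nth_add_box nth_append length_add_box le_Suc_eq max_def split: if_splits)
  moreover have "r < length (add_box m T r)" using assms by (simp add: length_add_box)
  ultimately show ?thesis unfolding column_iff by metis
qed

text \<open>Distinct rows have no common entry, so counting the entries of a column amounts to
  counting the rows that reach it.\<close>

lemma col_SYT:
  assumes T: "T \<in> SYT n" and k: "1 \<le> k"
  shows "col k T = card {i. i < length T \<and> k \<le> length (T ! i)}"
proof -
  let ?I = "{i. i < length T \<and> k \<le> length (T ! i)}"
  have "column k T = (\<lambda>i. T ! i ! (k - 1)) ` ?I"
    using k by (auto simp: column_iff)
  moreover have "inj_on (\<lambda>i. T ! i ! (k - 1)) ?I"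
  proof (rule inj_onI)
    fix i j assume *: "i \<in> ?I" "j \<in> ?I" "T ! i ! (k - 1) = T ! j ! (k - 1)"
    then have "T ! i ! (k - 1) \<in> set (T ! i)" "T ! i ! (k - 1) \<in> set (T ! j)"
      using k nth_mem[of "k - 1" "T ! i"] nth_mem[of "k - 1" "T ! j"] by auto
    then show "i = j" using SYT_disjoint[OF T] * by blast
  qed
  ultimately show ?thesis by (simp add: col_def card_image)
qed

lemma restrict_SYT:
  assumes "T \<in> SYT n" "n \<le> i"
  shows "restrict_tableau i T = T"
proof -
  have "map (filter (\<lambda>j. j \<le> i)) T = T"
    using assms SYT_row_le[of T n] by (fastforce intro!: map_idI simp: filter_id_conv)
  then show ?thesis
    using assms by (auto simp: restrict_tableau_def SYT_def filter_id_conv)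
qed

text \<open>Together with \<open>restrict_SYT\<close>, this lets \<open>restrict_tableau n\<close>
  undo the addition of \<open>Suc n\<close>: a row consisting of that entry alone is emptied and
  dropped.\<close>

lemma restrict_add_box:
  assumes "i < m"
  shows "restrict_tableau i (add_box m T r) = restrict_tableau i T"
proof (cases "r < length T")
  case True
  then have "map (filter (\<lambda>j. j \<le> i)) (T[r := T ! r @ [m]]) = map (filter (\<lambda>j. j \<le> i)) T"
    using assms by (simp add: map_update) (metis list_update_id nth_map)
  then show ?thesis using True by (simp add: restrict_tableau_def add_box_def)
qed (use assms in \<open>simp add: restrict_tableau_def add_box_def\<close>)

text \<open>\<open>sigma i\<close> depends only on the entries up to \<open>i\<close> and on the
  column of \<open>i\<close>, and a larger entry affects neither.\<close>

lemma sigma_add_box_old: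
  assumes "r \<le> length T" "i < m"
  shows "sigma i (add_box m T r) = sigma i T"
  using assms by (simp add: sigma_def Let_def restrict_add_box column_add_box_old)

lemma row_count_eq_count: "row_count k T = count (shape T) k"
proof -
  have "count (mset xs) k = length (filter (\<lambda>x. x = k) xs)" for xs :: "nat list"
    by (induction xs) auto
  then show ?thesis
    by (simp add: row_count_def shape_def length_filter_conv_card del: mset_map cong: conj_cong)
qed

text \<open>The first column now has \<open>Suc (length T)\<close> entries, and the
  \<open>+ 1\<close> in \<open>sigma\<close> cancels the new one. The value is the number of factors
  \<open>y\<^sub>0\<close>.\<close>

lemma sigma_add_box_top:
  assumes T: "T \<in> SYT n"
  shows "sigma (Suc n) (add_box (Suc n) T (length T)) = int (Suc n) - int (length T)"
proof -
  let ?T = "add_box (Suc n) T (length T)"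
  have T': "?T \<in> SYT (Suc n)" using T by (rule add_box_in_SYT) simp
  have new: "Suc n \<notin> set (concat T)" using SYT_set[OF T] by simp
  have "{i. i < length ?T \<and> 1 \<le> length (?T ! i)} = {..length T}"
    using SYT_nth_nonempty[OF T'] by (auto simp: length_add_box Suc_le_eq)
  then have "col 1 ?T = Suc (length T)" using col_SYT[OF T', of 1] by simp
  moreover have "Suc n \<in> column 1 ?T" using column_add_box_new[OF _ new, of "length T" 1] by simp
  ultimately show ?thesis using restrict_SYT[OF T'] by (simp add: sigma_def)
qed

text \<open>With \<open>k = length (T ! r)\<close>, the box enters column \<open>k + 1\<close>,
  where its contribution cancels the \<open>+ 1\<close> in \<open>sigma\<close>. What remains is the
  number of rows of \<open>T\<close> that reach column \<open>k\<close> but not column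
  \<open>k + 1\<close>, the multiplicity of \<open>y\<^sub>k\<close>.\<close>

lemma sigma_add_box_corner:
  assumes T: "T \<in> SYT n" and r: "r \<in> corners T"
  shows "sigma (Suc n) (add_box (Suc n) T r) = int (count (shape T) (length (T ! r)))"
proof -
  let ?T = "add_box (Suc n) T r"
  define k where "k = length (T ! r)"
  have rl: "r < length T" using r by (simp add: corners_def)
  then have k: "1 \<le> k" using SYT_nth_nonempty[OF T] by (simp add: k_def Suc_le_eq)
  have T': "?T \<in> SYT (Suc n)" using T r by (simp add: add_box_in_SYT)
  have new: "Suc n \<notin> set (concat T)" using SYT_set[OF T] by simp
  have col_iff: "Suc n \<in> column j ?T \<longleftrightarrow> j = Suc k" for j
    using column_add_box_new[OF _ new, of r j] rl by (simp add: k_def)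
  \<comment> \<open>Resolves the choice in \<open>sigma\<close>: \<open>col_iff\<close> leaves
    \<open>k\<close> as the only candidate.\<close>
  have the: "(THE j. Suc 0 \<le> j \<and> j = k) = k"
    using k by (intro the_equality) auto
  let ?C = "\<lambda>j. {i. i < length T \<and> j \<le> length (T ! i)}"
  have len: "length ?T = length T" using rl by (simp add: length_add_box)
  have nth: "length (?T ! i) = (if i = r then Suc k else length (T ! i))" if "i < length T" for i
    using that rl len by (simp add: nth_add_box k_def)
  have "{i. i < length ?T \<and> k \<le> length (?T ! i)} = ?C k"
    unfolding len by (auto simp: nth simp flip: k_def split: if_splits)
  then have "col k ?T = card (?C k)" using col_SYT[OF T' k] by simp
  moreover have "{i. i < length ?T \<and> Suc k \<le> length (?T ! i)} = insert r (?C (Suc k))"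
    unfolding len using rl by (auto simp: nth split: if_splits)
  then have "col (Suc k) ?T = Suc (card (?C (Suc k)))"
    using col_SYT[OF T', of "Suc k"] by (simp add: k_def)
  moreover have "?C k = ?C (Suc k) \<union> {i. i < length T \<and> length (T ! i) = k}"
    by auto
  moreover have "card (?C (Suc k) \<union> {i. i < length T \<and> length (T ! i) = k}) =
      card (?C (Suc k)) + row_count k T"
    unfolding row_count_def by (rule card_Un_disjoint) auto
  ultimately have "int (col k ?T) - int (col (Suc k) ?T) + 1 = int (row_count k T)"
    by simp
  then show ?thesis
    using restrict_SYT[OF T'] k
    by (simp add: sigma_def Let_def the col_iff row_count_eq_count flip: k_def)
qed

section \<open>The Leibniz rule for products of Eulerian polynomials\<close>

lemma sum_mset_conv_sum_set:
  fixes f :: "'a \<Rightarrow> 'b :: comm_semiring_1"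
  shows "(\<Sum>x\<in>#M. f x) = (\<Sum>x\<in>set_mset M. of_nat (count M x) * f x)"
proof (induction M)
  case (add x M)
  have "(\<Sum>y\<in>set_mset (add_mset x M). of_nat (count (add_mset x M) y) * f y)
      = (\<Sum>y\<in>insert x (set_mset M). of_nat (count M y) * f y + (if y = x then f y else 0))"
    by (intro sum.cong) (auto simp: algebra_simps)
  also have "\<dots> = (\<Sum>y\<in>insert x (set_mset M). of_nat (count M y) * f y) + f x"
    by (simp add: sum.distrib)
  also have "(\<Sum>y\<in>insert x (set_mset M). of_nat (count M y) * f y)
      = (\<Sum>y\<in>set_mset M. of_nat (count M y) * f y)"
    by (rule sum.mono_neutral_right) (auto simp: not_in_iff)
  finally show ?case using add by (simp add: add.commute)
qed simp

text \<open>Iterated Leibniz rule: each summand turns one factor \<open>D^k y\<close> into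
  \<open>D^(k + 1) y\<close>. A factor of index \<open>k\<close> has degree \<open>k + 1\<close>,
  whence the total degree \<open>sum_mset M + size M\<close>.\<close>

lemma eulerian_step_prod_mset:
  "eulerian_step (sum_mset M + size M) (\<Prod>k\<in>#M. eulerian_poly k) =
    (\<Sum>k\<in>#M. eulerian_poly (Suc k) * (\<Prod>j\<in>#M - {#k#}. eulerian_poly j))"
proof (induction M)
  case empty
  then show ?case by (simp add: eulerian_step_one)
next
  case (add x M)
  let ?P = "\<lambda>M. \<Prod>k\<in>#M. eulerian_poly k"
  have "eulerian_step (sum_mset (add_mset x M) + size (add_mset x M)) (?P (add_mset x M))
      = eulerian_step (Suc x + (sum_mset M + size M)) (eulerian_poly x * ?P M)"
    by (simp add: add_ac)
  also have "\<dots> = eulerian_poly (Suc x) * ?P M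
      + (\<Sum>k\<in>#M. eulerian_poly x * (eulerian_poly (Suc k) * ?P (M - {#k#})))"
    unfolding eulerian_step_mult add.IH by (simp add: eulerian_poly_Suc sum_mset_distrib_left)
  also have "(\<Sum>k\<in>#M. eulerian_poly x * (eulerian_poly (Suc k) * ?P (M - {#k#})))
      = (\<Sum>k\<in>#M. eulerian_poly (Suc k) * ?P (add_mset x M - {#k#}))"
    by (intro arg_cong[of _ _ sum_mset] image_mset_cong) (auto simp: mult_ac dest!: multi_member_split)
  finally show ?case by simp
qed

text \<open>Row lengths weakly decrease upwards, so among the rows of a given length exactly the
  lowest is a corner.\<close>

lemma bij_betw_corners:
  assumes T: "T \<in> SYT n"
  shows "bij_betw (\<lambda>r. length (T ! r)) (corners T) (set_mset (shape T))"
  unfolding bij_betw_def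
proof
  have less: "length (T ! r) < length (T ! q)" if "r \<in> corners T" "q < r" for q r
    using that SYT_length_mono[OF T, of q "r - 1"] by (fastforce simp: corners_def)
  show "inj_on (\<lambda>r. length (T ! r)) (corners T)"
  proof (rule inj_onI)
    fix r q assume "r \<in> corners T" "q \<in> corners T" "length (T ! r) = length (T ! q)"
    then show "r = q" using less[of r q] less[of q r] by (cases r q rule: linorder_cases) auto
  qed
  show "(\<lambda>r. length (T ! r)) ` corners T = set_mset (shape T)"
  proof
    show "(\<lambda>r. length (T ! r)) ` corners T \<subseteq> set_mset (shape T)"
      by (auto simp: corners_def shape_def)
    show "set_mset (shape T) \<subseteq> (\<lambda>r. length (T ! r)) ` corners T"
    proof
      fix k assume "k \<in># shape T"
      then obtain i where i: "i < length T" "length (T ! i) = k"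
        by (auto simp: shape_def in_set_conv_nth)
      \<comment> \<open>The minimum is taken over all indices; \<open>r \<le> i\<close> then ensures
        that it is an actual row.\<close>
      define r where "r = (LEAST r. length (T ! r) = k)"
      have r: "length (T ! r) = k" unfolding r_def by (rule LeastI) (rule i(2))
      have "r \<le> i" unfolding r_def by (rule Least_le) (rule i(2))
      have "length (T ! (r - 1)) \<noteq> k" if "r \<noteq> 0"
        using not_less_Least[of "r - 1" "\<lambda>r. length (T ! r) = k"] that by (simp add: r_def)
      moreover have "k \<le> length (T ! (r - 1))"
        using SYT_length_mono[OF T, of "r - 1" r] r \<open>r \<le> i\<close> i by simp
      ultimately have "r \<in> corners T"
        using r \<open>r \<le> i\<close> i by (cases "r = 0") (auto simp: corners_def)
      then show "k \<in> (\<lambda>r. length (T ! r)) ` corners T" using r by blast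
    qed
  qed
qed

lemma sum_mset_shape: "T \<in> SYT n \<Longrightarrow> sum_mset (shape T) = n"
  using distinct_card[of "concat T"] unfolding SYT_def shape_def sum_mset_sum_list
  by (simp add: length_concat del: set_concat)

lemma set_mset_shape:
  assumes "T \<in> SYT n"
  shows "set_mset (shape T) \<subseteq> {1..n}"
proof
  fix k assume k: "k \<in># shape T"
  then have "k \<le> sum_mset (shape T)" by (auto dest: multi_member_split)
  moreover have "k \<noteq> 0" using k assms by (auto simp: shape_def SYT_def)
  ultimately show "k \<in> {1..n}" using sum_mset_shape[OF assms] by simp
qed

text \<open>Each row has a box. This makes \<open>Suc n - length T\<close> a true
  difference.\<close>

lemma length_SYT_le:
  assumes "T \<in> SYT n"
  shows "length T \<le> n"
proof -
  have "size M \<le> sum_mset M" if "0 \<notin># M" for M :: "nat multiset"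
    using that by (induction M) auto
  moreover have "0 \<notin># shape T" using set_mset_shape[OF assms] by auto
  ultimately have "size (shape T) \<le> sum_mset (shape T)" .
  then show ?thesis
    unfolding sum_mset_shape[OF assms] by (simp add: shape_def)
qed

section \<open>Weights and summation over tableaux\<close>

text \<open>Takes the Eulerian factors row by row, so that adding a box replaces a single factor or
  inserts \<open>eulerian_poly 1\<close>.\<close>

definition SYT_weight :: "nat \<Rightarrow> nat list list \<Rightarrow> int poly" where
  "SYT_weight n T = (\<Prod>i=1..n. of_int (sigma i T)) * (\<Prod>k\<in>#shape T. eulerian_poly k)"

lemma SYT_weight_eq:
  assumes "T \<in> SYT n"
  shows "(\<Prod>i=1..n. of_int (sigma i T) * eulerian_poly i ^ row_count i T) = SYT_weight n T"
proof -
  have "(\<Prod>k\<in>#shape T. eulerian_poly k) =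
      (\<Prod>k\<in>set_mset (shape T). eulerian_poly k ^ count (shape T) k)"
    by (rule image_prod_mset_multiplicity)
  also have "\<dots> = (\<Prod>k=1..n. eulerian_poly k ^ count (shape T) k)"
    using set_mset_shape[OF assms] by (intro prod.mono_neutral_left) (auto simp: not_in_iff)
  finally show ?thesis
    by (simp add: SYT_weight_def prod.distrib row_count_eq_count)
qed

lemma SYT_weight_add_box:
  assumes "r \<le> length T"
  shows "SYT_weight (Suc n) (add_box (Suc n) T r) =
    (\<Prod>i=1..n. of_int (sigma i T)) * (of_int (sigma (Suc n) (add_box (Suc n) T r)) *
      (\<Prod>k\<in>#shape (add_box (Suc n) T r). eulerian_poly k))"
  using assms by (simp add: SYT_weight_def sigma_add_box_old less_Suc_eq_le)

text \<open>The ways to add a box match the distinct factors to which \<open>D\<close> applies. A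
  corner stands for the equal factors \<open>y\<^sub>k\<close>, the new row for the factors
  \<open>y\<^sub>0\<close>, with \<open>D y\<^sub>0 = y\<^sub>1\<close>, and \<open>sigma\<close> is
  the multiplicity in either case.\<close>

lemma sum_SYT_weight_add_box:
  assumes T: "T \<in> SYT n"
  shows "(\<Sum>r\<in>insert (length T) (corners T). SYT_weight (Suc n) (add_box (Suc n) T r)) =
    eulerian_step (Suc (2 * n)) (SYT_weight n T)"
proof -
  define s where "s = (\<Prod>i=1..n. sigma i T)"
  let ?P = "\<lambda>M. \<Prod>k\<in>#M. eulerian_poly k"
  let ?M = "shape T"
  define F where "F k = eulerian_poly (Suc k) * ?P (?M - {#k#})" for k
  have s: "(\<Prod>i=1..n. of_int (sigma i T)) = (of_int s :: int poly)"
    by (simp add: s_def)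
  have corner: "SYT_weight (Suc n) (add_box (Suc n) T r) =
      of_int s * (of_nat (count ?M (length (T ! r))) * F (length (T ! r)))"
    if "r \<in> corners T" for r
    using that SYT_weight_add_box[of r T n, unfolded s] sigma_add_box_corner[OF T that]
    by (simp add: F_def corners_def shape_add_box_corner)
  have top: "SYT_weight (Suc n) (add_box (Suc n) T (length T)) =
      of_int s * (of_nat (Suc n - length T) * (monom 1 1 * ?P ?M))"
    using SYT_weight_add_box[of "length T" T n, unfolded s] sigma_add_box_top[OF T]
      length_SYT_le[OF T] eulerian_poly_1 by (simp add: shape_add_box_top of_nat_diff)
  have "length T \<notin> corners T" by (simp add: corners_def)
  have "(\<Sum>r\<in>corners T. of_nat (count ?M (length (T ! r))) * F (length (T ! r)))
      = (\<Sum>k\<in>#?M. F k)"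
    unfolding sum_mset_conv_sum_set
    by (rule sum.reindex_bij_betw[OF bij_betw_corners[OF T]])
  also have "\<dots> = eulerian_step (n + length T) (?P ?M)"
    using eulerian_step_prod_mset[of ?M] sum_mset_shape[OF T] by (simp add: F_def shape_def)
  finally have "(\<Sum>r\<in>insert (length T) (corners T). SYT_weight (Suc n) (add_box (Suc n) T r))
      = of_int s * (of_nat (Suc n - length T) * (monom 1 1 * ?P ?M)
        + eulerian_step (n + length T) (?P ?M))"
    using \<open>length T \<notin> corners T\<close> finite_corners
    by (simp add: corner top distrib_left flip: sum_distrib_left)
  \<comment> \<open>The factor \<open>1\<close> stands for \<open>y\<close> to the power
    \<open>Suc n - length T\<close>, that is, for the factors \<open>y\<^sub>0\<close>; with it the
    total degree becomes \<open>2 * n + 1\<close>.\<close>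
  also have "of_nat (Suc n - length T) * (monom 1 1 * ?P ?M) + eulerian_step (n + length T) (?P ?M)
      = eulerian_step ((Suc n - length T) + (n + length T)) (1 * ?P ?M)"
    unfolding eulerian_step_mult by (simp add: eulerian_step_one mult.assoc)
  also have "(Suc n - length T) + (n + length T) = Suc (2 * n)"
    using length_SYT_le[OF T] by simp
  finally show ?thesis
    unfolding SYT_weight_def s by (simp add: eulerian_step_of_int_mult)
qed

text \<open>Deleting \<open>Suc n\<close> recovers \<open>T\<close>, and the row that contains
  \<open>Suc n\<close> is \<open>r\<close>.\<close>

lemma bij_betw_add_box:
  "bij_betw (\<lambda>(T, r). add_box (Suc n) T r)
     (SIGMA T:SYT n. insert (length T) (corners T)) (SYT (Suc n))"
  (is "bij_betw ?f ?S _")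
  unfolding bij_betw_def
proof
  show "inj_on ?f ?S"
  proof (rule inj_onI, clarify del: insertE)
    fix T r U q
    assume *: "T \<in> SYT n" "r \<in> insert (length T) (corners T)" "U \<in> SYT n"
      "q \<in> insert (length U) (corners U)" and eq: "add_box (Suc n) T r = add_box (Suc n) U q"
    have rq: "r \<le> length T" "q \<le> length U" using * by (auto simp: corners_def)
    have "T = U"
      using restrict_add_box[of n "Suc n" T r] restrict_add_box[of n "Suc n" U q] eq
        restrict_SYT[of T n n] restrict_SYT[of U n n] * by simp
    moreover have "r = q"
    proof (rule SYT_disjoint)
      show "add_box (Suc n) T r \<in> SYT (Suc n)" using * by (simp add: add_box_in_SYT)
      show len: "r < length (add_box (Suc n) T r)" "q < length (add_box (Suc n) T r)"
        using length_add_box[OF rq(1), of "Suc n"] length_add_box[OF rq(2), of "Suc n"] eq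
        by simp_all
      show "Suc n \<in> set (add_box (Suc n) T r ! r)" "Suc n \<in> set (add_box (Suc n) T r ! q)"
        using len nth_add_box[of r T r "Suc n"] nth_add_box[of q U q "Suc n"] rq eq by auto
    qed
    ultimately show "T = U \<and> r = q" ..
  qed
  show "?f ` ?S = SYT (Suc n)"
  proof
    show "?f ` ?S \<subseteq> SYT (Suc n)" by (clarify del: insertE) (rule add_box_in_SYT)
    show "SYT (Suc n) \<subseteq> ?f ` ?S"
    proof
      fix T' assume "T' \<in> SYT (Suc n)"
      then obtain T r where
        "T \<in> SYT n" "r \<in> insert (length T) (corners T)" "T' = add_box (Suc n) T r"
        by (rule SYT_Suc_cases)
      then have "(T, r) \<in> ?S" "T' = ?f (T, r)" by simp_all
      then show "T' \<in> ?f ` ?S" by (rule rev_image_eqI)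
    qed
  qed
qed

text \<open>Both sides are 1 at \<open>n = 0\<close> and satisfy the same recurrence, the step for
  tableaux being summed by linearity.\<close>

lemma sum_SYT_weight: "(\<Sum>T\<in>SYT n. SYT_weight n T) = stirling_word_poly 2 n"
proof (induction n)
  case 0
  have "SYT 0 = {[]}"
  proof
    show "SYT 0 \<subseteq> {[]}" using length_SYT_le by fastforce
  qed (simp add: SYT_def)
  then show ?case by (simp add: SYT_weight_def shape_def stirling_word_poly_0)
next
  case (Suc n)
  have "(\<Sum>T\<in>SYT (Suc n). SYT_weight (Suc n) T)
      = (\<Sum>(T, r)\<in>(SIGMA T:SYT n. insert (length T) (corners T)).
          SYT_weight (Suc n) (add_box (Suc n) T r))"
    using sum.reindex_bij_betw[OF bij_betw_add_box, of "SYT_weight (Suc n)" n]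
    by (simp add: split_def)
  also have "\<dots> = (\<Sum>T\<in>SYT n. eulerian_step (Suc (2 * n)) (SYT_weight n T))"
    by (subst sum.Sigma[symmetric])
      (auto simp: finite_SYT finite_corners sum_SYT_weight_add_box simp del: sum.insert intro!: sum.cong)
  also have "\<dots> = stirling_word_poly 2 (Suc n)"
    by (simp add: Suc stirling_word_poly_Suc flip: eulerian_step_sum)
  finally show ?case .
qed

theorem theorem4p7:
  fixes n :: nat
  assumes "n > 0"
  shows "stirling_eulerian_poly n =
    (\<Sum>T\<in>SYT n. \<Prod>i=1..n. of_int (sigma i T) * eulerian_poly i ^ row_count i T)"
  unfolding stirling_eulerian_poly_eq sum_SYT_weight[symmetric]
  by (intro sum.cong refl SYT_weight_eq[symmetric])

end
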